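(* For $2\le B\le 10$, the fixed points of $S_B$ and the cycles of $S_B$ of length at least $2$ are exactly the following (all numerals written in base $B$; "(and its conjugate)" means the cycle obtained by complex conjugation of every element is also a cycle; each listed cycle $z_0\to z_1\to\cdots\to z_0$ means $S_B(z_0)=z_1$, etc.): $B=2$: fixed points $0,1$; no other cycles. $B=3$: fixed points $0,1,12,22,2+11i,2-11i$; cycles $2\to 11\to 2$; $-1+2i\to -10-11i\to -1+2i$ (and its conjugate); $-11+22i\to -20-22i\to -11+22i$ (and its conjugate). $B=4$: fixed points $0,1$; no other cycles. $B=5$: fixed points $0,1,23,33$; cycles $4\to 31\to 20\to 4$; $3+11i\to 12+11i\to 3+11i$ (and its conjugate). $B=6$: fixed points $0,1$; cycle $5\to 41\to 25\to 45\to 105\to 42\to 32\to 21\to 5$. $B=7$: fixed points $0,1,13,34,44,63,25+31i,25-31i$; cycles $2\to 4\to 22\to 11\to 2$; $16\to 52\to 41\to 23\to 16$; $-15+116i\to -15-116i\to -15+116i$; $-31+44i\to -31-44i\to -31+44i$; $-11+51i\to -33-15i\to -11+51i$ (and its conjugate); $-21+26i\to -50-26i\to -21+26i$ (and its conjugate); $-1+13i\to -12-6i\to -43+33i\to 10-60i\to -50-15i\to -1+13i$ (and its conjugate); $4+22i\to 11+22i\to -6+11i\to 46-15i\to 35-125i\to 4-116i\to -31-66i\to -116+66i\to -46-150i\to 35+55i\to -22+143i\to -24-40i\to 4+22i$ (and its conjugate); $14+35i\to -23+64i\to -54-66i\to -43+213i\to 14-35i\to -23-64i\to -54+66i\to -43-213i\to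 14+35i$; $-13+15i\to -22-44i\to -33+44i\to -20-66i\to -125+33i\to 15-60i\to -13-15i\to -22+44i\to -33-44i\to -20+66i\to -125-33i\to 15+60i\to -13+15i$. $B=8$: fixed points $0,1,24,64,15+32i,15-32i,45+20i,45-20i$; cycles $4\to 20\to 4$; $15\to 32\to 15$; $5\to 31\to 12\to 5$; $-34+72i\to -34-72i\to -34+72i$; $-11+24i\to -22-14i\to -11+24i$ (and its conjugate); $-40+70i\to -41-70i\to -40+70i$ (and its conjugate); $4+6i\to -24+60i\to -20-30i\to -5+14i\to 10-50i\to -30-12i\to 4+6i$ (and its conjugate). $B=9$: fixed points $0,1,45,55$; cycles $75\to 82\to 75$; $58\to 108\to 72\to 58$; $-4+26i\to -26-53i\to 6+62i\to -4+26i$ (and its conjugate); $10+26i\to -43+4i\to 10-26i\to -43-4i\to 10+26i$. $B=10$: fixed points $0,1$; cycles $4\to 16\to 37\to 58\to 89\to 145\to 42\to 20\to 4$; $-52+90i\to -52-90i\to -52+90i$; $35+48i\to -46+104i\to 35-48i\to -46-104i\to 35+48i$; $-15+90i\to -55-18i\to -15+90i$ (and its conjugate).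
   Context: Fix an integer $B\ge 2$. Every nonzero Gaussian integer $a+bi$ is written uniquely as $a+bi=\sum_{j=0}^n (a_j+b_ji)B^j$ with $a_j,b_j\in\mathbb{Z}$, $a_n,b_n$ not both $0$, and for each $j$: $|a_j|\le B-1$, $|b_j|\le B-1$, $\operatorname{sgn}(a)a_j\ge 0$, $\operatorname{sgn}(b)b_j\ge 0$. The Gaussian $B$-happy function $S_B:\mathbb{Z}[i]\to\mathbb{Z}[i]$ is defined by $S_B(0)=0$ and $S_B(a+bi)=\sum_{j=0}^n (a_j+b_ji)^2$. A cycle of length $k$ is a set of $k$ distinct points $g_0,\dots,g_{k-1}$ with $S_B(g_j)=g_{j+1}$ ($j<k-1$) and $S_B(g_{k-1})=g_0$; fixed points are cycles of length 1. Notation: a numeral such as $-15+116i$ in base $7$ denotes $-(1\cdot 7+5)+(1\cdot 7^2+1\cdot 7+6)i$, i.e. the real and imaginary parts are given by their signs and the base-$B$ digit strings of their absolute values. *)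

theory Defs
  imports Complex_Main
begin

definition gauss_ints :: "complex set" where
  "gauss_ints = {z. Re z \<in> \<int> \<and> Im z \<in> \<int>}"

definition gauss_int :: "int \<Rightarrow> int \<Rightarrow> complex" where
  "gauss_int a b = Complex (of_int a) (of_int b)"

definition gauss_expansion ::
  "nat \<Rightarrow> complex \<Rightarrow> nat \<Rightarrow> (nat \<Rightarrow> int) \<Rightarrow> (nat \<Rightarrow> int) \<Rightarrow> bool" where
  "gauss_expansion B z n a b \<longleftrightarrow>
     z = (\<Sum>j\<le>n. gauss_int (a j) (b j) * of_nat B ^ j) \<and>
     (a n \<noteq> 0 \<or> b n \<noteq> 0) \<and>
     (\<forall>j\<le>n. \<bar>a j\<bar> \<le> int B - 1 \<and> \<bar>b j\<bar> \<le> int B - 1 \<and>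
            sgn (Re z) * of_int (a j) \<ge> 0 \<and> sgn (Im z) * of_int (b j) \<ge> 0)"

(* Well defined on nonzero Gaussian integers for B >= 2, by gauss_expansion_exists
   and gauss_expansion_unique below. *)
definition gauss_happy :: "nat \<Rightarrow> complex \<Rightarrow> complex" where
  "gauss_happy B z =
     (if z = 0 then 0
      else THE s. \<exists>n a b. gauss_expansion B z n a b \<and> s = (\<Sum>j\<le>n. (gauss_int (a j) (b j))\<^sup>2))"

definition fixed_points :: "nat \<Rightarrow> complex set" where
  "fixed_points B = {z \<in> gauss_ints. gauss_happy B z = z}"

definition cycle_listing :: "nat \<Rightarrow> complex list \<Rightarrow> bool" where
  "cycle_listing B gs \<longleftrightarrow>
     gs \<noteq> [] \<and> set gs \<subseteq> gauss_ints \<and> distinct gs \<and>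
     (\<forall>j < length gs - 1. gauss_happy B (gs ! j) = gs ! (j + 1)) \<and>
     gauss_happy B (last gs) = hd gs"

definition is_cycle :: "nat \<Rightarrow> nat \<Rightarrow> complex set \<Rightarrow> bool" where
  "is_cycle B k C \<longleftrightarrow> (\<exists>gs. cycle_listing B gs \<and> length gs = k \<and> C = set gs)"

(* Every list in L is traversed by the happy function in the order written, and the underlying
   sets are precisely the cycles of length at least 2. *)
definition cycles_are :: "nat \<Rightarrow> complex list set \<Rightarrow> bool" where
  "cycles_are B L \<longleftrightarrow>
     (\<forall>gs\<in>L. cycle_listing B gs) \<and> {C. \<exists>k\<ge>2. is_cycle B k C} = set ` L"

definition with_conjugates :: "complex list set \<Rightarrow> complex list set" where
  "with_conjugates L = L \<union> map cnj ` L"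

(* Reads the decimal digit string of n as a numeral in base B; for instance
   digit_string 7 116 = 1 * 7^2 + 1 * 7 + 6. *)
fun digit_string :: "nat \<Rightarrow> nat \<Rightarrow> nat" where
  "digit_string B n = (if n = 0 then 0 else digit_string B (n div 10) * B + n mod 10)"

declare digit_string.simps [simp del]

(* gauss_numeral B (x, y) is the numeral written x+yi in base B. *)
definition gauss_numeral :: "nat \<Rightarrow> int \<times> int \<Rightarrow> complex" where
  "gauss_numeral B = (\<lambda>(x, y).
     gauss_int (sgn x * int (digit_string B (nat \<bar>x\<bar>))) (sgn y * int (digit_string B (nat \<bar>y\<bar>))))"

lemma digits_zero:
  fixes d :: "nat \<Rightarrow> int"
  assumes "B \<ge> 2" and "\<And>j. \<bar>d j\<bar> \<le> int B - 1"
    and "(\<Sum>j<N. d j * int B ^ j) = 0" and "j < N"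
  shows "d j = 0"
  using assms(2-4)
proof (induction N arbitrary: d j)
  case (Suc N)
  define e where "e = (\<Sum>j<N. d (Suc j) * int B ^ j)"
  have s: "d 0 + int B * e = 0"
    using Suc.prems(2) unfolding e_def sum.lessThan_Suc_shift
    by (simp add: sum_distrib_left algebra_simps)
  hence "int B dvd d 0"
    by (metis add_eq_0_iff dvd_minus_iff dvd_triv_left)
  hence d0: "d 0 = 0"
    using Suc.prems(1)[of 0] dvd_imp_le_int[of "d 0" "int B"] by auto
  with s assms(1) have "e = 0" by simp
  hence "d (Suc i) = 0" if "i < N" for i
    using Suc.IH[of "\<lambda>j. d (Suc j)" i] Suc.prems(1) that unfolding e_def by blast
  with d0 Suc.prems(3) show ?case by (cases j) auto
qed simp

lemma digits_unique:
  fixes a a' :: "nat \<Rightarrow> int"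
  assumes B: "B \<ge> 2" and a: "\<And>j. \<bar>a j\<bar> \<le> int B - 1" and a': "\<And>j. \<bar>a' j\<bar> \<le> int B - 1"
    and s: "\<And>j. sgn x * a j \<ge> 0" and s': "\<And>j. sgn x * a' j \<ge> 0"
    and x: "x = (\<Sum>j<N. a j * int B ^ j)" and x': "x = (\<Sum>j<N. a' j * int B ^ j)"
    and j: "j < N"
  shows "a j = a' j"
proof (cases "x = 0")
  case True
  then show ?thesis
    using digits_zero[of B a N j, OF B a _ j] digits_zero[of B a' N j, OF B a' _ j] x x' by auto
next
  case False
  have "\<bar>a j - a' j\<bar> \<le> int B - 1" for j
    using a[of j] a'[of j] s[of j] s'[of j] False by (auto simp: sgn_if split: if_splits)
  moreover have "(\<Sum>j<N. (a j - a' j) * int B ^ j) = 0"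
    using x x' by (simp add: left_diff_distrib sum_subtractf)
  ultimately show ?thesis
    using digits_zero[OF B, of "\<lambda>j. a j - a' j" N j] j by simp
qed

lemma gauss_int_sum:
  "(\<Sum>j\<in>A. gauss_int (a j) (b j) * of_nat B ^ j) =
   gauss_int (\<Sum>j\<in>A. a j * int B ^ j) (\<Sum>j\<in>A. b j * int B ^ j)"
proof -
  have "gauss_int x y * of_nat B ^ j = gauss_int (x * int B ^ j) (y * int B ^ j)" for x y j
    by (simp add: gauss_int_def complex_eq_iff flip: of_nat_power)
  then show ?thesis
    by (induction A rule: infinite_finite_induct)
      (auto simp: gauss_int_def complex_eq_iff)
qed

lemma gauss_expansion_padded:
  assumes "gauss_expansion B (gauss_int x y) n a b" and "B \<ge> 2" and "n < N"
  defines "a' \<equiv> \<lambda>j. if j \<le> n then a j else 0" and "b' \<equiv> \<lambda>j. if j \<le> n then b j else 0"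
  shows "\<bar>a' j\<bar> \<le> int B - 1" "\<bar>b' j\<bar> \<le> int B - 1" "sgn x * a' j \<ge> 0" "sgn y * b' j \<ge> 0"
    "x = (\<Sum>j<N. a' j * int B ^ j)" "y = (\<Sum>j<N. b' j * int B ^ j)"
proof -
  have sg: "sgn (real_of_int u) * of_int v \<ge> 0 \<longleftrightarrow> sgn u * v \<ge> 0" for u v :: int
    by (auto simp: sgn_if)
  show "\<bar>a' j\<bar> \<le> int B - 1" "\<bar>b' j\<bar> \<le> int B - 1" "sgn x * a' j \<ge> 0" "sgn y * b' j \<ge> 0"
    using assms(1,2) by (auto simp: gauss_expansion_def a'_def b'_def gauss_int_def sg)
  have pad: "(\<Sum>j\<le>n. f j * int B ^ j) = (\<Sum>j<N. (if j \<le> n then f j else 0) * int B ^ j)" for f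
    by (rule sum.mono_neutral_cong_left) (use assms(3) in auto)
  have "gauss_int x y = gauss_int (\<Sum>j\<le>n. a j * int B ^ j) (\<Sum>j\<le>n. b j * int B ^ j)"
    using assms(1) by (simp add: gauss_expansion_def gauss_int_sum)
  then have "x = (\<Sum>j\<le>n. a j * int B ^ j)" "y = (\<Sum>j\<le>n. b j * int B ^ j)"
    unfolding gauss_int_def complex.inject of_int_eq_iff by auto
  then show "x = (\<Sum>j<N. a' j * int B ^ j)" "y = (\<Sum>j<N. b' j * int B ^ j)"
    unfolding a'_def b'_def pad by auto
qed

lemma gauss_expansion_unique:
  assumes B: "B \<ge> 2" and z: "z \<in> gauss_ints"
    and e: "gauss_expansion B z n a b" and e': "gauss_expansion B z n' a' b'"
  shows "n = n' \<and> (\<forall>j\<le>n. a j = a' j \<and> b j = b' j)"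
proof -
  obtain x y where xy: "z = gauss_int x y"
    using z by (auto simp: gauss_ints_def gauss_int_def complex_eq_iff elim!: Ints_cases)
  define N where "N = Suc (max n n')"
  have N: "n < N" "n' < N" by (auto simp: N_def)
  note p = gauss_expansion_padded[OF e[unfolded xy] B N(1)]
    and p' = gauss_expansion_padded[OF e'[unfolded xy] B N(2)]
  have *: "(if j \<le> n then a j else 0) = (if j \<le> n' then a' j else 0)"
    "(if j \<le> n then b j else 0) = (if j \<le> n' then b' j else 0)" if "j < N" for j
    using digits_unique[OF B p(1) p'(1) p(3) p'(3) p(5) p'(5) that]
      digits_unique[OF B p(2) p'(2) p(4) p'(4) p(6) p'(6) that] by auto
  have "a n \<noteq> 0 \<or> b n \<noteq> 0" "a' n' \<noteq> 0 \<or> b' n' \<noteq> 0"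
    using e e' by (auto simp: gauss_expansion_def)
  with *[of n] *[of n'] N have "n = n'" by (auto split: if_splits)
  moreover have "a j = a' j \<and> b j = b' j" if "j \<le> n" for j
    using *[of j] that N \<open>n = n'\<close> by auto
  ultimately show ?thesis by blast
qed

lemma digits_sum:
  fixes x :: int
  assumes "B \<ge> 2" and "0 \<le> x"
  shows "(\<Sum>j<N. x div int B ^ j mod int B * int B ^ j) = x mod int B ^ N"
proof (induction N)
  case (Suc N)
  then show ?case
    using zmod_zmult2_eq[of "int B" x "int B ^ N"] assms
    by (simp add: mult.commute)
qed simp

lemma gauss_expansion_exists:
  assumes B: "B \<ge> 2" and z: "z \<in> gauss_ints" "z \<noteq> 0"
  shows "\<exists>n a b. gauss_expansion B z n a b"
proof -
  obtain x y where xy: "z = gauss_int x y"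
    using z by (auto simp: gauss_ints_def gauss_int_def complex_eq_iff elim!: Ints_cases)
  define N where "N = nat (\<bar>x\<bar> + \<bar>y\<bar>)"
  define dg where "dg = (\<lambda>u j. sgn u * (\<bar>u\<bar> div int B ^ j mod int B))"
  have "N < B ^ N"
    using less_exp[of N] power_mono[of 2 B N] B by linarith
  then have "int N < int B ^ N"
    by (metis of_nat_less_iff of_nat_power)
  then have lt: "\<bar>x\<bar> < int B ^ N" "\<bar>y\<bar> < int B ^ N" by (auto simp: N_def)
  have sm: "(\<Sum>j<M. dg u j * int B ^ j) = u" if "\<bar>u\<bar> < int B ^ N" "M \<ge> N" for u M
  proof -
    have "\<bar>u\<bar> < int B ^ M"
      using that B power_increasing[of N M "int B"] by linarith
    then have "\<bar>u\<bar> mod int B ^ M = \<bar>u\<bar>" by simp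
    then show ?thesis
      using digits_sum[OF B, of "\<bar>u\<bar>" M]
      by (simp add: dg_def mult.assoc flip: sum_distrib_left) (simp add: sgn_mult_abs)
  qed
  define J where "J = {j. dg x j \<noteq> 0 \<or> dg y j \<noteq> 0}"
  have J: "J \<subseteq> {..<N}"
  proof
    fix j assume "j \<in> J"
    moreover have "dg u j = 0" if "\<bar>u\<bar> < int B ^ N" "j \<ge> N" for u
    proof -
      have "\<bar>u\<bar> < int B ^ j"
        using that B power_increasing[of N j "int B"] by linarith
      then show ?thesis by (simp add: dg_def)
    qed
    ultimately show "j \<in> {..<N}" using lt by (force simp: J_def)
  qed
  then have fin: "finite J" by (rule finite_subset) simp
  have "J \<noteq> {}"
  proof
    assume "J = {}"
    then have "x = 0" "y = 0"
      using sm[OF lt(1) order.refl] sm[OF lt(2) order.refl] by (auto simp: J_def)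
    then show False using z xy by (simp add: gauss_int_def complex_eq_iff)
  qed
  define n where "n = Max J"
  have nJ: "n \<in> J" using fin \<open>J \<noteq> {}\<close> by (simp add: n_def)
  have "j \<le> n" if "j \<in> J" for j using that fin by (simp add: n_def)
  then have sub: "(\<Sum>j\<le>n. dg u j * int B ^ j) = (\<Sum>j<N. dg u j * int B ^ j)" if "u \<in> {x, y}" for u
    by (intro sum.mono_neutral_left) (use that nJ J in \<open>force simp: J_def\<close>)+
  have "z = (\<Sum>j\<le>n. gauss_int (dg x j) (dg y j) * of_nat B ^ j)"
    using sub sm lt by (simp add: gauss_int_sum xy)
  moreover have "dg x n \<noteq> 0 \<or> dg y n \<noteq> 0" using nJ by (simp add: J_def)
  moreover have "\<bar>dg u j\<bar> \<le> int B - 1" "sgn (real_of_int u) * of_int (dg u j) \<ge> 0" for u j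
    using B pos_mod_bound[of "int B" "\<bar>u\<bar> div int B ^ j"]
    by (auto simp: dg_def sgn_if abs_mult)
  moreover have "Re z = of_int x" "Im z = of_int y" by (simp_all add: xy gauss_int_def)
  ultimately have "gauss_expansion B z n (dg x) (dg y)"
    unfolding gauss_expansion_def by metis
  then show ?thesis by blast
qed

end

theory Submission
  imports Defs
begin

text \<open>
  Up to the signs of real and imaginary part, \<open>S\<^sub>B\<close> acts on the closed quadrant, where appending the
  digits \<open>i, j\<close> multiplies \<open>|x| + |y|\<close> by at least \<open>B\<close> but increases the same norm of the image
  by at most \<open>2 (B - 1)\<^sup>2\<close>. A point of least norm on a cycle is not mapped to a point of smaller
  norm, so only finitely many points, enumerated by their leading digits, can be such minima. For
  each of them the orbit either drops below the starting norm or hits a known cycle.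
\<close>

text \<open>All digits of the real part share one sign, and so do those of the imaginary part. So
  the real part of the image ignores both signs, and its imaginary part sees only their product.
  Iterating with absolute values therefore gives the true orbit up to conjugation at each time,
  which is why every representative has to be accounted for together with its conjugate. The
  obstacle is cost: the finite check runs by rewriting with code equations, so most points must be
  discarded without following their orbits. Tests on a common prefix of digits dispose of all its
  extensions at once. Points with odd imaginary part lie on no cycle, since the imaginary part of an
  image is a sum of doubled products, and their orbits are skipped. The arithmetic is recast so that
  shared subterms are computed once.\<close>

subsection \<open>Digit-wise squaring on the closed quadrant\<close>

function hsum :: "int \<Rightarrow> int \<Rightarrow> int \<Rightarrow> int \<times> int" where
  "hsum B x y =
     (if B < 2 \<or> x < 0 \<or> y < 0 \<or> x = 0 \<and> y = 0 then (0, 0)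
      else (case hsum B (x div B) (y div B) of (u, d) \<Rightarrow>
        (u + ((x mod B)\<^sup>2 - (y mod B)\<^sup>2), d + 2 * (x mod B) * (y mod B))))"
  by pat_completeness auto
termination
proof (relation "measure (\<lambda>(B, x, y). nat (x + y))")
  fix B x y :: int
  assume *: "\<not> (B < 2 \<or> x < 0 \<or> y < 0 \<or> x = 0 \<and> y = 0)"
  have "z div B \<le> z" "0 < z \<longrightarrow> z div B < z" if "z \<ge> 0" for z
    using * that int_div_less_self[of z B] by (cases "z = 0"; force)+
  then show "((B, x div B, y div B), (B, x, y)) \<in> measure (\<lambda>(B, x, y). nat (x + y))"
    using * by (smt (verit) case_prod_conv in_measure zless_nat_conj)
qed simp

declare hsum.simps [simp del]

lemma hsum_zero [simp]: "hsum B 0 0 = (0, 0)"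
  by (simp add: hsum.simps)

lemma hsum_digit:
  assumes "B \<ge> 2" "0 \<le> x" "0 \<le> y" "0 \<le> i" "i < B" "0 \<le> j" "j < B"
  shows "hsum B (B * x + i) (B * y + j) =
    (fst (hsum B x y) + (i\<^sup>2 - j\<^sup>2), snd (hsum B x y) + 2 * i * j)"
proof (cases "B * x + i = 0 \<and> B * y + j = 0")
  case True
  moreover have "0 \<le> B * x" "0 \<le> B * y" using assms by simp_all
  ultimately have "i = 0" "j = 0" "B * x = 0" "B * y = 0" using assms by linarith+
  then show ?thesis using assms by simp
next
  case False
  have "0 \<le> B * x" "0 \<le> B * y" using assms by simp_all
  then have "\<not> (B * x + i < 0)" "\<not> (B * y + j < 0)" using assms by linarith+
  then show ?thesis
    using False assms by (subst hsum.simps) (auto simp: split_beta)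
qed

text \<open>Each digit pair contributes \<open>2 * i * j\<close>, which is nonnegative, even, and
  zero if a coordinate vanishes. The last fact makes it harmless that \<open>sgn\<close> of a zero
  coordinate is 0 in \<open>happy_pair\<close>; evenness supplies the parity filter.\<close>

lemma hsum_snd:
  "0 \<le> snd (hsum B x y)" "x = 0 \<or> y = 0 \<Longrightarrow> snd (hsum B x y) = 0"
  "even (snd (hsum B x y))"
proof (induction B x y rule: hsum.induct)
  case (1 B x y)
  {
    case 1
    show ?case
      using "1.IH" by (subst hsum.simps) (auto simp: split_beta)
  next
    case 2
    then show ?case
      using "1.IH" by (subst hsum.simps) (auto simp: split_beta)
  next
    case 3
    show ?case
      using "1.IH" by (subst hsum.simps) (auto simp: split_beta)
  }
qed

text \<open>Induction peels off the lowest digit by shifting indices. Leading zeros are allowed, so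
  \<open>N\<close> may exceed the true length.\<close>

lemma hsum_digit_sum:
  fixes a b :: "nat \<Rightarrow> int"
  assumes "B \<ge> 2" "\<And>j. 0 \<le> a j \<and> a j < B" "\<And>j. 0 \<le> b j \<and> b j < B"
  shows "hsum B (\<Sum>j<N. a j * B ^ j) (\<Sum>j<N. b j * B ^ j) =
    (\<Sum>j<N. (a j)\<^sup>2 - (b j)\<^sup>2, \<Sum>j<N. 2 * a j * b j)"
  using assms(2,3)
proof (induction N arbitrary: a b)
  case (Suc N)
  have shift: "(\<Sum>j<Suc N. c j * B ^ j) = B * (\<Sum>j<N. c (Suc j) * B ^ j) + c 0" for c :: "nat \<Rightarrow> int"
    unfolding sum.lessThan_Suc_shift by (simp add: sum_distrib_left algebra_simps)
  have nonneg: "0 \<le> (\<Sum>j<N. c (Suc j) * B ^ j)" if "\<And>j. 0 \<le> c j \<and> c j < B" for c :: "nat \<Rightarrow> int"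
    using assms(1) that by (intro sum_nonneg mult_nonneg_nonneg) auto
  have "hsum B (\<Sum>j<N. a (Suc j) * B ^ j) (\<Sum>j<N. b (Suc j) * B ^ j) =
    (\<Sum>j<N. (a (Suc j))\<^sup>2 - (b (Suc j))\<^sup>2, \<Sum>j<N. 2 * a (Suc j) * b (Suc j))"
    by (rule Suc.IH) (use Suc.prems in auto)
  then show ?case
    unfolding shift
    using hsum_digit[OF assms(1) nonneg[of a] nonneg[of b], of "a 0" "b 0"] Suc.prems
    unfolding sum.lessThan_Suc_shift by (simp add: add.commute)
qed simp

subsection \<open>The happy function on pairs of integers\<close>

definition of_pair :: "int \<times> int \<Rightarrow> complex" where
  "of_pair p = gauss_int (fst p) (snd p)"

text \<open>If every digit pair has the form \<open>(s * a, t * b)\<close> with fixed signs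
  \<open>s\<close>, \<open>t\<close>, its square has real part \<open>a^2 - b^2\<close> and
  imaginary part \<open>s * t * 2 * a * b\<close>; hence the single factor in front of
  \<open>d\<close>.\<close>

definition happy_pair :: "nat \<Rightarrow> int \<times> int \<Rightarrow> int \<times> int" where
  "happy_pair B p = (case hsum (int B) \<bar>fst p\<bar> \<bar>snd p\<bar> of (u, d) \<Rightarrow>
     (u, sgn (fst p) * sgn (snd p) * d))"

lemma of_pair_eq_iff [simp]: "of_pair p = of_pair q \<longleftrightarrow> p = q"
  by (auto simp: of_pair_def gauss_int_def prod_eq_iff)

lemma of_pair_gauss_ints [simp]: "of_pair p \<in> gauss_ints"
  by (simp add: of_pair_def gauss_int_def gauss_ints_def)

lemma gauss_intsE:
  assumes "z \<in> gauss_ints"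
  obtains p where "z = of_pair p"
  using assms by (fastforce simp: gauss_ints_def of_pair_def gauss_int_def complex_eq_iff elim!: Ints_cases)

lemma cnj_of_pair: "cnj (of_pair p) = of_pair (fst p, - snd p)"
  by (simp add: of_pair_def gauss_int_def complex_eq_iff)

lemma sum_gauss_int_squares:
  "(\<Sum>j\<in>A. (gauss_int (a j) (b j))\<^sup>2) =
   gauss_int (\<Sum>j\<in>A. (a j)\<^sup>2 - (b j)\<^sup>2) (\<Sum>j\<in>A. 2 * a j * b j)"
  by (simp add: gauss_int_def complex_eq_iff power2_eq_square mult.assoc)

lemma signed_digits_abs:
  fixes a :: "nat \<Rightarrow> int"
  assumes B: "B \<ge> 2" and a: "\<And>j. \<bar>a j\<bar> \<le> int B - 1" and s: "\<And>j. sgn x * a j \<ge> 0"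
    and x: "x = (\<Sum>j<N. a j * int B ^ j)"
  shows "\<bar>x\<bar> = (\<Sum>j<N. \<bar>a j\<bar> * int B ^ j)" and "j < N \<Longrightarrow> a j = sgn x * \<bar>a j\<bar>"
proof -
  have sg: "a j = sgn x * \<bar>a j\<bar>" if "j < N" for j
  proof (cases "x = 0")
    \<comment> \<open>Here \<open>sgn x = 0\<close> and the sign condition says nothing; the digits
      vanish because zero has only the zero expansion.\<close>
    case True
    then show ?thesis using digits_zero[of B a N j, OF B a _ that] x by simp
  next
    case False
    then show ?thesis using s[of j] by (auto simp: sgn_if split: if_splits)
  qed
  then show "j < N \<Longrightarrow> a j = sgn x * \<bar>a j\<bar>" .
  have "\<bar>x\<bar> = sgn x * x" by (simp add: abs_sgn)
  also have "\<dots> = (\<Sum>j<N. sgn x * a j * int B ^ j)"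
    by (subst (2) x) (simp add: sum_distrib_left mult.assoc)
  also have "\<dots> = (\<Sum>j<N. \<bar>a j\<bar> * int B ^ j)"
  proof (rule sum.cong)
    fix j assume "j \<in> {..<N}"
    then have "a j = sgn x * \<bar>a j\<bar>" using sg by blast
    then have "sgn x * a j = \<bar>a j\<bar>"
      using s[of j] by (auto simp: sgn_if split: if_splits)
    then show "sgn x * a j * int B ^ j = \<bar>a j\<bar> * int B ^ j" by simp
  qed simp
  finally show "\<bar>x\<bar> = (\<Sum>j<N. \<bar>a j\<bar> * int B ^ j)" .
qed

text \<open>Uniqueness of the expansion resolves the description operator, and the signed digits
  then factor into common signs and absolute values, to which \<open>hsum_digit_sum\<close> applies.
  From here on everything is integer arithmetic.\<close>

lemma gauss_happy_of_pair:
  assumes B: "B \<ge> 2"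
  shows "gauss_happy B (of_pair p) = of_pair (happy_pair B p)"
proof (cases "of_pair p = 0")
  case True
  then show ?thesis
    by (simp add: gauss_happy_def happy_pair_def of_pair_def gauss_int_def complex_eq_iff)
next
  case False
  obtain x y where p: "p = (x, y)" by fastforce
  have z: "of_pair p = gauss_int x y" by (simp add: p of_pair_def)
  obtain n a b where e: "gauss_expansion B (gauss_int x y) n a b"
    using gauss_expansion_exists[OF B of_pair_gauss_ints False] z by auto
  have "gauss_happy B (of_pair p) = (\<Sum>j\<le>n. (gauss_int (a j) (b j))\<^sup>2)"
    unfolding gauss_happy_def z
  proof (subst if_not_P, use False z in simp, rule the_equality)
    fix s assume "\<exists>m c d. gauss_expansion B (gauss_int x y) m c d \<and>
      s = (\<Sum>j\<le>m. (gauss_int (c j) (d j))\<^sup>2)"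
    then obtain m c d where m: "gauss_expansion B (gauss_int x y) m c d"
      "s = (\<Sum>j\<le>m. (gauss_int (c j) (d j))\<^sup>2)" by blast
    with gauss_expansion_unique[OF B _ e m(1)] of_pair_gauss_ints[of p] z
    show "s = (\<Sum>j\<le>n. (gauss_int (a j) (b j))\<^sup>2)" by simp
  qed (use e in blast)
  \<comment> \<open>Zero padding makes the digit bounds and sign conditions hold at every index,
    also beyond \<open>n\<close>, as the digit lemmas require.\<close>
  moreover define a' where "a' j = (if j \<le> n then a j else 0)" for j
  moreover define b' where "b' j = (if j \<le> n then b j else 0)" for j
  ultimately have h: "gauss_happy B (of_pair p) = (\<Sum>j<Suc n. (gauss_int (a' j) (b' j))\<^sup>2)"
    by (simp add: lessThan_Suc_atMost)
  note e' = gauss_expansion_padded[OF e B lessI, folded a'_def b'_def]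
  note A = signed_digits_abs[OF B e'(1,3,5)] and B' = signed_digits_abs[OF B e'(2,4,6)]
  have "hsum (int B) \<bar>x\<bar> \<bar>y\<bar> =
    (\<Sum>j<Suc n. \<bar>a' j\<bar>\<^sup>2 - \<bar>b' j\<bar>\<^sup>2, \<Sum>j<Suc n. 2 * \<bar>a' j\<bar> * \<bar>b' j\<bar>)"
    unfolding A(1) B'(1) by (rule hsum_digit_sum) (use B e'(1,2) in \<open>auto simp: less_le_not_le\<close>)
  moreover have "sgn x * sgn y * (\<Sum>j<Suc n. 2 * \<bar>a' j\<bar> * \<bar>b' j\<bar>) = (\<Sum>j<Suc n. 2 * a' j * b' j)"
    unfolding sum_distrib_left
  proof (rule sum.cong)
    fix j assume "j \<in> {..<Suc n}"
    then have "a' j = sgn x * \<bar>a' j\<bar>" "b' j = sgn y * \<bar>b' j\<bar>" using A(2) B'(2) by blast+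
    then have "2 * a' j * b' j = 2 * (sgn x * \<bar>a' j\<bar>) * (sgn y * \<bar>b' j\<bar>)" by argo
    then show "sgn x * sgn y * (2 * \<bar>a' j\<bar> * \<bar>b' j\<bar>) = 2 * a' j * b' j"
      by (simp add: mult_ac)
  qed simp
  ultimately show ?thesis
    unfolding h sum_gauss_int_squares by (simp add: happy_pair_def of_pair_def p)
qed

subsection \<open>Reduction modulo signs\<close>

definition quad_step :: "int \<Rightarrow> int \<times> int \<Rightarrow> int \<times> int" where
  "quad_step B p = hsum B \<bar>fst p\<bar> \<bar>snd p\<bar>"

definition norm1 :: "int \<times> int \<Rightarrow> int" where
  "norm1 p = \<bar>fst p\<bar> + \<bar>snd p\<bar>"

lemma happy_pair_quad_step:
  "fst (happy_pair B p) = fst (quad_step (int B) p)"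
  "\<bar>snd (happy_pair B p)\<bar> = \<bar>snd (quad_step (int B) p)\<bar>"
  using hsum_snd(2)[of "\<bar>fst p\<bar>" "\<bar>snd p\<bar>" "int B"]
  by (auto simp: happy_pair_def quad_step_def split_beta abs_mult sgn_if)

text \<open>\<open>quad_step\<close> takes absolute values first, so it cannot tell
  \<open>happy_pair B q\<close> from the \<open>quad_step\<close> image of \<open>q\<close>. One
  final \<open>quad_step\<close> thus turns agreement up to sign into equality, whence the shift by
  one.\<close>

lemma quad_step_happy_iterate:
  "quad_step (int B) ((happy_pair B ^^ n) p) = (quad_step (int B) ^^ Suc n) p"
proof (induction n)
  case (Suc n)
  have "quad_step (int B) (happy_pair B q) = quad_step (int B) (quad_step (int B) q)" for q
    by (subst (1 2) quad_step_def) (simp add: happy_pair_quad_step)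
  with Suc show ?case by simp
qed simp

lemma happy_iterate_quad_step:
  assumes "n > 0"
  shows "fst ((happy_pair B ^^ n) p) = fst ((quad_step (int B) ^^ n) p)"
    and "\<bar>snd ((happy_pair B ^^ n) p)\<bar> = \<bar>snd ((quad_step (int B) ^^ n) p)\<bar>"
proof -
  obtain m where n: "n = Suc m" using assms gr0_implies_Suc by blast
  show "fst ((happy_pair B ^^ n) p) = fst ((quad_step (int B) ^^ n) p)"
    "\<bar>snd ((happy_pair B ^^ n) p)\<bar> = \<bar>snd ((quad_step (int B) ^^ n) p)\<bar>"
    using happy_pair_quad_step[of B "(happy_pair B ^^ m) p"] quad_step_happy_iterate[of B m p]
    by (simp_all add: n)
qed

text \<open>Points of a cycle are values of \<open>S\<^sub>B\<close>, so their imaginary parts are even.\<close>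

definition settles :: "int \<Rightarrow> (int \<times> int) set \<Rightarrow> int \<times> int \<Rightarrow> bool" where
  "settles B R p \<longleftrightarrow> even (snd p) \<longrightarrow>
     (\<exists>n>0. norm1 ((quad_step B ^^ n) p) < norm1 p \<or> (quad_step B ^^ n) p \<in> R)"

lemma settles_abs: "settles B R (\<bar>fst p\<bar>, \<bar>snd p\<bar>) \<longleftrightarrow> settles B R p"
proof -
  have "(quad_step B ^^ n) (\<bar>fst p\<bar>, \<bar>snd p\<bar>) = (quad_step B ^^ n) p" if "n > 0" for n
  proof -
    obtain m where n: "n = Suc m" using \<open>n > 0\<close> gr0_implies_Suc by blast
    show ?thesis unfolding n funpow_Suc_right by (simp add: quad_step_def)
  qed
  moreover have "norm1 (\<bar>fst p\<bar>, \<bar>snd p\<bar>) = norm1 p" by (simp add: norm1_def)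
  ultimately show ?thesis by (auto simp: settles_def)
qed

text \<open>An element of least \<open>norm1\<close> on a cycle cannot descend, so it must run into \<open>R\<close>.\<close>

lemma periodic_meets_representative:
  assumes settles: "\<And>x y. 0 \<le> x \<Longrightarrow> 0 \<le> y \<Longrightarrow> settles (int B) R (x, y)"
    and per: "(happy_pair B ^^ k) p = p" "k > 0"
  obtains n u d where "(u, d) \<in> R" "(happy_pair B ^^ n) p \<in> {(u, d), (u, - d)}"
proof -
  obtain i where i: "\<And>j. nat (norm1 ((happy_pair B ^^ i) p)) \<le> nat (norm1 ((happy_pair B ^^ j) p))"
    using ex_has_least_nat[of "\<lambda>_. True" 0 "\<lambda>i. nat (norm1 ((happy_pair B ^^ i) p))"] by blast
  define q where "q = (happy_pair B ^^ i) p"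
  have "settles (int B) R q"
    using settles[of "\<bar>fst q\<bar>" "\<bar>snd q\<bar>"] settles_abs[of "int B" R q] by simp
  moreover have "even (snd q)"
  proof -
    have "q = (happy_pair B ^^ (i + k)) p" using per(1) by (simp add: q_def funpow_add)
    then have "q = happy_pair B ((happy_pair B ^^ (i + k - 1)) p)"
      using per(2) by (metis Suc_diff_1 add_gr_0 comp_apply funpow.simps(2))
    then show ?thesis by (simp add: happy_pair_def split_beta hsum_snd(3))
  qed
  ultimately obtain n where n: "n > 0" "norm1 ((quad_step (int B) ^^ n) q) < norm1 q \<or>
      (quad_step (int B) ^^ n) q \<in> R"
    by (auto simp: settles_def)
  note hn = happy_iterate_quad_step[OF n(1), of B q]
  have hq: "(happy_pair B ^^ n) q = (happy_pair B ^^ (n + i)) p"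
    by (simp add: q_def funpow_add)
  have "0 \<le> norm1 w" for w by (simp add: norm1_def)
  then have "norm1 q \<le> norm1 ((happy_pair B ^^ n) q)"
    using i[of "n + i"] unfolding hq[symmetric] q_def[symmetric] by (simp add: nat_le_eq_zle)
  then have "(quad_step (int B) ^^ n) q \<in> R"
    using n(2) hn by (simp add: norm1_def)
  moreover obtain u d where "(quad_step (int B) ^^ n) q = (u, d)" by fastforce
  ultimately show thesis
    using that[of u d "n + i"] hn unfolding hq by (auto simp: prod_eq_iff abs_eq_iff)
qed

subsection \<open>Cycles as orbits\<close>

lemma cycle_listing_funpow:
  assumes "cycle_listing B gs" "j < length gs"
  shows "(gauss_happy B ^^ i) (gs ! j) = gs ! ((j + i) mod length gs)"
proof (induction i)
  case (Suc i)
  define l where "l = (j + i) mod length gs"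
  have l: "l < length gs" unfolding l_def by (rule mod_less_divisor) (use assms(2) in linarith)
  have "gauss_happy B (gs ! l) = gs ! (Suc l mod length gs)"
  proof (cases "Suc l = length gs")
    case True
    then have "l = length gs - 1" "gs \<noteq> []" by auto
    then have "gs ! l = last gs" "gs ! 0 = hd gs"
      by (simp_all add: last_conv_nth hd_conv_nth)
    then show ?thesis using assms(1) True by (simp add: cycle_listing_def)
  next
    case False
    then show ?thesis using assms(1) l by (simp add: cycle_listing_def)
  qed
  then show ?case
    using Suc by (simp add: l_def mod_Suc_eq)
qed (use assms in simp)

text \<open>Since a cycle is the orbit of any of its points, two cycles with a common point have the
  same underlying set.\<close>

lemma cycle_listing_orbit:
  assumes "cycle_listing B gs" "z \<in> set gs"
  shows "(gauss_happy B ^^ length gs) z = z"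
    and "set gs = range (\<lambda>i. (gauss_happy B ^^ i) z)"
proof -
  obtain j where j: "j < length gs" "z = gs ! j" using assms(2) by (metis in_set_conv_nth)
  show "(gauss_happy B ^^ length gs) z = z"
    using cycle_listing_funpow[OF assms(1) j(1)] j by simp
  show "set gs = range (\<lambda>i. (gauss_happy B ^^ i) z)"
  proof (intro equalityI subsetI)
    fix w assume "w \<in> set gs"
    then obtain l where l: "l < length gs" "w = gs ! l" by (metis in_set_conv_nth)
    have "(gauss_happy B ^^ (length gs - j + l)) z = w"
      using cycle_listing_funpow[OF assms(1) j(1)] j l by simp
    then show "w \<in> range (\<lambda>i. (gauss_happy B ^^ i) z)" by blast
  next
    fix w assume "w \<in> range (\<lambda>i. (gauss_happy B ^^ i) z)"
    then obtain i where "w = gs ! ((j + i) mod length gs)"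
      using cycle_listing_funpow[OF assms(1) j(1)] j(2) by auto
    moreover have "(j + i) mod length gs < length gs"
      using j(1) by (intro mod_less_divisor) linarith
    ultimately show "w \<in> set gs" by simp
  qed
qed

lemma fixed_not_in_long_cycle:
  assumes "cycle_listing B gs" "length gs \<ge> 2" "z \<in> set gs"
  shows "gauss_happy B z \<noteq> z"
proof
  assume fixed: "gauss_happy B z = z"
  have "(gauss_happy B ^^ i) z = z" for i
    by (induction i) (simp_all add: fixed)
  then have "set gs = {z}" using cycle_listing_orbit(2)[OF assms(1,3)] by auto
  moreover have "card (set gs) = length gs"
    using assms(1) by (simp add: cycle_listing_def distinct_card)
  ultimately show False using assms(2) by simp
qed

text \<open>A periodic point reaches \<open>R\<close> up to conjugation, hence a listed fixed point
  or cycle. The listed points are closed under the happy function, and periodicity brings the orbit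
  back to its start inside them.\<close>

lemma classification_from_representatives:
  assumes B: "B \<ge> 2"
    and settles: "\<And>x y. 0 \<le> x \<Longrightarrow> 0 \<le> y \<Longrightarrow> settles (int B) R (x, y)"
    and R: "\<And>u d. (u, d) \<in> R \<Longrightarrow>
      of_pair (u, d) \<in> F \<union> \<Union> (set ` L) \<and> of_pair (u, - d) \<in> F \<union> \<Union> (set ` L)"
    and F: "\<And>z. z \<in> F \<Longrightarrow> z \<in> gauss_ints \<and> gauss_happy B z = z"
    and L: "\<And>gs. gs \<in> L \<Longrightarrow> cycle_listing B gs \<and> length gs \<ge> 2"
  shows "fixed_points B = F \<and> cycles_are B L"
proof -
  define U where "U = F \<union> \<Union> (set ` L)"
  have closed: "(gauss_happy B ^^ n) z \<in> U" if zU: "z \<in> U" for z n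
  proof (cases "z \<in> F")
    case True
    have "(gauss_happy B ^^ n) z = z"
      using F[OF True] by (induction n) simp_all
    then show ?thesis using zU by simp
  next
    case False
    then obtain gs where gs: "gs \<in> L" "z \<in> set gs" using zU by (auto simp: U_def)
    then have "(gauss_happy B ^^ n) z \<in> set gs"
      using cycle_listing_orbit(2)[of B gs z] L by blast
    then show ?thesis using gs(1) by (auto simp: U_def)
  qed
  have periodic: "z \<in> U" if z: "z \<in> gauss_ints" "(gauss_happy B ^^ k) z = z" "k > 0" for z k
  proof -
    obtain p where p: "z = of_pair p" using z(1) by (rule gauss_intsE)
    have iter: "(gauss_happy B ^^ n) z = of_pair ((happy_pair B ^^ n) p)" for n
      by (induction n) (simp_all add: p gauss_happy_of_pair[OF B])
    have "(happy_pair B ^^ k) p = p" using z(2) unfolding iter unfolding p by simp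
    then obtain n u d where n: "(u, d) \<in> R" "(happy_pair B ^^ n) p \<in> {(u, d), (u, - d)}"
      using periodic_meets_representative[OF settles _ z(3), of p] by blast
    then have U: "(gauss_happy B ^^ n) z \<in> U"
      using R[OF n(1)] by (auto simp: iter U_def)
    have "(gauss_happy B ^^ (k * m)) z = z" for m
      by (induction m) (simp_all add: funpow_add z(2))
    \<comment> \<open>After \<open>n\<close> steps into the listed points, \<open>k * n - n\<close>
      more complete a multiple of the period.\<close>
    moreover have "k * n = (k * n - n) + n" using z(3) by simp
    ultimately have "(gauss_happy B ^^ (k * n - n)) ((gauss_happy B ^^ n) z) = z"
      by (metis comp_apply funpow_add)
    then show ?thesis using closed[OF U] by metis
  qed
  have cyc: "\<exists>k>0. (gauss_happy B ^^ k) z = z" "z \<in> gauss_ints"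
    if "cycle_listing B gs" "z \<in> set gs" for gs z
    using cycle_listing_orbit(1)[OF that] that by (auto simp: cycle_listing_def)
  have "fixed_points B = F"
  proof (intro equalityI subsetI)
    fix z assume "z \<in> fixed_points B"
    then have z: "z \<in> gauss_ints" "gauss_happy B z = z" by (auto simp: fixed_points_def)
    then have "z \<in> U" using periodic[of z 1] by simp
    then show "z \<in> F" using fixed_not_in_long_cycle L z(2) by (auto simp: U_def)
  qed (use F in \<open>auto simp: fixed_points_def\<close>)
  moreover have "{C. \<exists>k\<ge>2. is_cycle B k C} = set ` L"
  proof (intro equalityI subsetI)
    fix C assume "C \<in> {C. \<exists>k\<ge>2. is_cycle B k C}"
    then obtain gs where gs: "cycle_listing B gs" "length gs \<ge> 2" "C = set gs"
      by (auto simp: is_cycle_def)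
    then have "hd gs \<in> set gs" by (cases gs) auto
    with gs have z: "hd gs \<in> U" "hd gs \<notin> F"
      using cyc periodic fixed_not_in_long_cycle F by blast+
    then obtain hs where hs: "hs \<in> L" "hd gs \<in> set hs" by (auto simp: U_def)
    then have "set hs = C"
      using cycle_listing_orbit(2) L gs \<open>hd gs \<in> set gs\<close> by metis
    then show "C \<in> set ` L" using hs(1) by blast
  qed (use L in \<open>auto simp: is_cycle_def\<close>)
  ultimately show ?thesis using L by (auto simp: cycles_are_def)
qed

subsection \<open>A search over leading digits\<close>

text \<open>For each cycle, up to signs, the element of least \<open>norm1\<close>, in decimal notation; the sign of the
  imaginary part is the one produced by \<open>quad_step\<close>.\<close>

definition cycle_reps :: "int \<Rightarrow> (int \<times> int) list" where
  "cycle_reps B = [(0, 0), (1, 0)] @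
     (if B = 3 then [(2, 0), (-1, 2), (5, 0), (2, 4), (8, 0), (-4, 8)]
      else if B = 5 then [(4, 0), (3, 6), (13, 0), (18, 0)]
      else if B = 6 then [(5, 0)]
      else if B = 7 then
        [(2, 0), (10, 0), (-1, 10), (13, 0), (-6, 8), (-10, 12), (25, 0), (32, 0), (-15, 20),
         (-24, 12), (11, 26), (19, 22), (45, 0), (-22, 32), (-12, 62)]
      else if B = 8 then
        [(4, 0), (5, 0), (4, 6), (13, 0), (20, 0), (-9, 20), (13, 26), (52, 0), (37, 16),
         (-28, 58), (-32, 56)]
      else if B = 9 then [(-4, 24), (9, 24), (41, 0), (50, 0), (53, 0), (68, 0)]
      else if B = 10 then [(4, 0), (-55, 18), (35, 48), (-52, 90)]
      else [])"

text \<open>\<open>k\<close> is fuel, and running out counts as failure. \<open>f\<close> stays the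
  norm of the starting point, while \<open>p\<close> starts as its first image, so immediate success
  still means a positive number of steps.\<close>

function descends :: "int \<Rightarrow> int \<Rightarrow> int \<Rightarrow> int \<times> int \<Rightarrow> bool" where
  "descends k B f p =
     (if k \<le> 0 then False else if norm1 p < f then True else if p \<in> set (cycle_reps B) then True
      else descends (k - 1) B f (quad_step B p))"
  by pat_completeness auto
termination by (relation "measure (\<lambda>(k, _). nat k)") auto

declare descends.simps [simp del]

text \<open>With \<open>f\<close> the norm of a point and \<open>p\<close> its image, both conditions persist when digits are
  appended: the first makes the point and all its extensions descend, the second (for \<open>f \<noteq> 0\<close>)
  only its proper extensions. Extensions of \<open>0\<close> are reached from the root of the search.\<close>

definition small_norm :: "int \<Rightarrow> int \<Rightarrow> int \<times> int \<Rightarrow> bool" where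
  "small_norm B f p \<longleftrightarrow> norm1 p < f \<and> 2 * (B - 1) \<le> f"

definition small_below :: "int \<Rightarrow> int \<Rightarrow> int \<times> int \<Rightarrow> bool" where
  "small_below B f p \<longleftrightarrow> f = 0 \<or> norm1 p + 2 * (B - 1)\<^sup>2 < B * f"

text \<open>Examines the points obtained by appending a digit pair, at most \<open>(i, j)\<close> lexicographically, to
  \<open>(x / B, y / B)\<close>, whose image is \<open>(u, d)\<close>; \<open>k\<close> bounds the number of further digits, and 80
  exceeds the longest descent that occurs.\<close>

function search :: "int \<Rightarrow> int \<Rightarrow> int \<Rightarrow> int \<Rightarrow> int \<Rightarrow> int \<Rightarrow> int \<Rightarrow> int \<Rightarrow> bool" where
  "search k B i j x y u d =
     (if i < 0 then True
      else if j < 0 then search k B (i - 1) (B - 1) x y u d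
      else if small_norm B (x + i + (y + j)) (u + (i\<^sup>2 - j\<^sup>2), d + 2 * i * j)
      then search k B i (j - 1) x y u d
      else if (if (y + j) mod 2 = 0
        then descends 80 B (x + i + (y + j)) (u + (i\<^sup>2 - j\<^sup>2), d + 2 * i * j) else True) then
        (if small_below B (x + i + (y + j)) (u + (i\<^sup>2 - j\<^sup>2), d + 2 * i * j) then True
         else if k \<le> 0 then False
         else search (k - 1) B (B - 1) (B - 1) (B * (x + i)) (B * (y + j))
           (u + (i\<^sup>2 - j\<^sup>2)) (d + 2 * i * j)) \<and>
        search k B i (j - 1) x y u d
      else False)"
  by pat_completeness auto
termination
  by (relation "measures [\<lambda>(k, B, i, j, _). nat k, \<lambda>(k, B, i, j, _). nat (i + 1),
    \<lambda>(k, B, i, j, _). nat (j + 1)]") auto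

declare search.simps [simp del]

section \<open>Soundness of the search\<close>

lemma descends_sound:
  "descends k B f p \<Longrightarrow> \<exists>n. norm1 ((quad_step B ^^ n) p) < f \<or>
    (quad_step B ^^ n) p \<in> set (cycle_reps B)"
proof (induction k B f p rule: descends.induct)
  case (1 k B f p)
  show ?case
  proof (cases "norm1 p < f \<or> p \<in> set (cycle_reps B)")
    case True
    then show ?thesis by (intro exI[of _ 0]) auto
  next
    case False
    moreover have "\<not> k \<le> 0" "descends (k - 1) B f (quad_step B p)"
      using 1(2) False unfolding descends.simps[of k] by (auto split: if_splits)
    ultimately obtain n where "norm1 ((quad_step B ^^ n) (quad_step B p)) < f \<or>
        (quad_step B ^^ n) (quad_step B p) \<in> set (cycle_reps B)"
      using 1(1) by blast
    then show ?thesis by (intro exI[of _ "Suc n"]) (simp add: funpow_Suc_right del: funpow.simps)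
  qed
qed

lemma settlesI_descends:
  assumes "0 \<le> x" "0 \<le> y" "descends k B (x + y) (hsum B x y)"
  shows "settles B (set (cycle_reps B)) (x, y)"
proof -
  obtain n where "norm1 ((quad_step B ^^ n) (hsum B x y)) < x + y \<or>
      (quad_step B ^^ n) (hsum B x y) \<in> set (cycle_reps B)"
    using descends_sound[OF assms(3)] by blast
  then show ?thesis
    unfolding settles_def using assms
    by (intro impI exI[of _ "Suc n"]) (simp add: funpow_Suc_right quad_step_def norm1_def del: funpow.simps)
qed

lemma settlesI_small:
  assumes "0 \<le> x" "0 \<le> y" "norm1 (hsum B x y) < x + y"
  shows "settles B R (x, y)"
  unfolding settles_def using assms by (intro impI exI[of _ 1]) (simp add: quad_step_def norm1_def)

text \<open>From \<open>(i - j)^2 >= 0\<close> one gets \<open>2 * i * j <= i^2 + j^2\<close>, so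
  \<open>|i^2 - j^2| + 2 * i * j\<close> is at most twice the larger square.\<close>

lemma norm1_digit_le:
  assumes "0 \<le> i" "i \<le> c" "0 \<le> j" "j \<le> (c::int)"
  shows "norm1 (u + (i\<^sup>2 - j\<^sup>2), d + 2 * i * j) \<le> norm1 (u, d) + 2 * c\<^sup>2"
proof -
  have "i\<^sup>2 \<le> c\<^sup>2" "j\<^sup>2 \<le> c\<^sup>2" using assms by (simp_all add: power_mono)
  moreover have "0 \<le> (i - j)\<^sup>2" by simp
  moreover have "0 \<le> i * j" using assms by simp
  ultimately have "\<bar>i\<^sup>2 - j\<^sup>2\<bar> + \<bar>2 * i * j\<bar> \<le> 2 * c\<^sup>2"
    by (auto simp: power2_diff abs_if)
  then show ?thesis unfolding norm1_def by simp
qed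

lemma norm1_hsum_div:
  assumes "B \<ge> 2" "0 \<le> x" "0 \<le> y"
  shows "norm1 (hsum B x y) \<le> norm1 (hsum B (x div B) (y div B)) + 2 * (B - 1)\<^sup>2"
    and "B * (x div B + y div B) \<le> x + y"
proof -
  have m: "0 \<le> z mod B" "z mod B < B" "z mod B \<le> B - 1" "B * (z div B) + z mod B = z" for z
    using assms(1) pos_mod_bound[of B z] by simp_all
  have "0 \<le> z div B" if "0 \<le> z" for z using that assms(1) by (simp add: pos_imp_zdiv_nonneg_iff)
  then show "norm1 (hsum B x y) \<le> norm1 (hsum B (x div B) (y div B)) + 2 * (B - 1)\<^sup>2"
    using norm1_digit_le[OF m(1,3) m(1,3), of "fst (hsum B (x div B) (y div B))" x y
        "snd (hsum B (x div B) (y div B))"] assms m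
      hsum_digit[of B "x div B" "y div B" "x mod B" "y mod B"] by simp
  show "B * (x div B + y div B) \<le> x + y"
    unfolding distrib_left using m(1)[of x] m(4)[of x] m(1)[of y] m(4)[of y] by linarith
qed

lemma div_power_Suc: "(x::int) div B ^ Suc n = x div B div B ^ n" if "B \<ge> 2"
  using that by (simp add: zdiv_zmult2_eq)

lemma div_power_Suc_right: "(x::int) div B ^ Suc n = x div B ^ n div B" if "B \<ge> 2"
  using that by (simp add: zdiv_zmult2_eq power_Suc2 del: power_Suc)

text \<open>With prefix norm \<open>s >= 2 * (B - 1)\<close>, the growth
  \<open>2 * (B - 1)^2\<close> of the image is at most \<open>(B - 1) * s\<close>, which is covered
  by the growth of the point from \<open>s\<close> to at least \<open>B * s\<close>.\<close>

lemma small_norm_extend: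
  assumes "B \<ge> 2" "0 \<le> x" "0 \<le> y"
    and "small_norm B (x div B ^ n + y div B ^ n) (hsum B (x div B ^ n) (y div B ^ n))"
  shows "small_norm B (x + y) (hsum B x y)"
  using assms(2-4)
proof (induction n arbitrary: x y)
  case (Suc n)
  define s where "s = x div B + y div B"
  have "0 \<le> x div B" "0 \<le> y div B" using Suc.prems assms(1) by (simp_all add: pos_imp_zdiv_nonneg_iff)
  then have s: "norm1 (hsum B (x div B) (y div B)) < s" "2 * (B - 1) \<le> s"
    using Suc.IH[of "x div B" "y div B"] Suc.prems(3)
    unfolding div_power_Suc[OF assms(1)] small_norm_def s_def by auto
  have "(B - 1) * (2 * (B - 1)) \<le> (B - 1) * s"
    using s(2) assms(1) by (intro mult_left_mono) auto
  then have "s + 2 * (B - 1)\<^sup>2 \<le> B * s"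
    by (simp add: power2_eq_square algebra_simps)
  moreover have "s \<le> B * s" using s(2) assms(1) by (simp add: mult_le_cancel_right1)
  ultimately show ?case
    using norm1_hsum_div[OF assms(1) Suc.prems(1,2)] s unfolding small_norm_def s_def[symmetric]
    by linarith
qed simp

text \<open>The bound \<open>B * s\<close> on the left side for a prefix of norm \<open>s\<close> is
  at most the norm of the longer point, which gives descent. It also exceeds
  \<open>2 * (B - 1)^2\<close>, so adding that constant once more stays below
  \<open>2 * B * s\<close>, hence below \<open>B\<close> times the new norm.\<close>

lemma small_below_extend:
  assumes "B \<ge> 2" "0 \<le> x" "0 \<le> y"
    and "norm1 (hsum B (x div B ^ n) (y div B ^ n)) + 2 * (B - 1)\<^sup>2 < B * (x div B ^ n + y div B ^ n)"
  shows "norm1 (hsum B x y) + 2 * (B - 1)\<^sup>2 < B * (x + y) \<and> (n > 0 \<longrightarrow> norm1 (hsum B x y) < x + y)"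
  using assms(2-4)
proof (induction n arbitrary: x y)
  case (Suc n)
  define s where "s = x div B + y div B"
  have "0 \<le> x div B" "0 \<le> y div B" using Suc.prems assms(1) by (simp_all add: pos_imp_zdiv_nonneg_iff)
  then have s: "norm1 (hsum B (x div B) (y div B)) + 2 * (B - 1)\<^sup>2 < B * s"
    using Suc.IH[of "x div B" "y div B"] Suc.prems(3)
    unfolding div_power_Suc[OF assms(1)] s_def by blast
  note d = norm1_hsum_div[OF assms(1) Suc.prems(1,2), folded s_def]
  \<comment> \<open>Naming the products leaves a purely linear problem.\<close>
  define c where "c = 2 * (B - 1)\<^sup>2"
  define v where "v = B * s"
  define w where "w = B * (x + y)"
  have "0 \<le> norm1 (hsum B (x div B) (y div B))" by (simp add: norm1_def)
  moreover have "2 * (x + y) \<le> w"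
    unfolding w_def using assms(1) Suc.prems by (intro mult_right_mono) auto
  moreover have "2 * v \<le> 2 * (x + y)" using d(2) by (simp add: v_def)
  ultimately show ?case
    using d s unfolding c_def[symmetric] v_def[symmetric] w_def[symmetric]
    by (intro conjI impI) linarith+
qed simp

text \<open>\<open>div B ^ n\<close> deletes the last \<open>n\<close> digits, so
  \<open>(x, y)\<close> is a prefix of \<open>(x', y')\<close>. Every point extends
  \<open>(0, 0)\<close> by leading zeros; the last clause keeps the claim for \<open>(0, 0)\<close>
  from being the whole theorem.\<close>

definition settled_below :: "int \<Rightarrow> int \<Rightarrow> int \<Rightarrow> bool" where
  "settled_below B x y \<longleftrightarrow> (\<forall>n x' y'. 0 \<le> x' \<longrightarrow> 0 \<le> y' \<longrightarrow> x' div B ^ n = x \<longrightarrow> y' div B ^ n = y \<longrightarrow>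
     n = 0 \<or> x + y \<noteq> 0 \<longrightarrow> settles B (set (cycle_reps B)) (x', y'))"

lemma settled_belowD:
  assumes "settled_below B (x div B ^ n) (y div B ^ n)" "0 \<le> x" "0 \<le> y"
    and "n = 0 \<or> x div B ^ n + y div B ^ n \<noteq> 0"
  shows "settles B (set (cycle_reps B)) (x, y)"
  using assms unfolding settled_below_def by blast

lemma settled_below_children:
  assumes B: "B \<ge> 2"
    and "settles B (set (cycle_reps B)) (x, y)" "0 \<le> x" "0 \<le> y"
    and children: "\<And>i j. 0 \<le> i \<Longrightarrow> i < B \<Longrightarrow> 0 \<le> j \<Longrightarrow> j < B \<Longrightarrow> settled_below B (B * x + i) (B * y + j)"
  shows "settled_below B x y"
  unfolding settled_below_def
proof (intro allI impI)
  fix n x' y'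
  assume *: "0 \<le> x'" "0 \<le> y'" "x' div B ^ n = x" "y' div B ^ n = y" "n = 0 \<or> x + y \<noteq> 0"
  show "settles B (set (cycle_reps B)) (x', y')"
  proof (cases n)
    case 0
    then show ?thesis using * assms by simp
  next
    case (Suc m)
    have last: "x' div B ^ m = B * x + x' div B ^ m mod B" "y' div B ^ m = B * y + y' div B ^ m mod B"
      using *(3,4) mult_div_mod_eq[of B "x' div B ^ m"] mult_div_mod_eq[of B "y' div B ^ m"]
      unfolding Suc div_power_Suc_right[OF B] by simp_all
    have m: "0 \<le> z mod B" "z mod B < B" for z
      using B by simp_all
    have "0 \<le> B * x" "0 \<le> B * y" "x \<le> B * x" "y \<le> B * y"
      using assms by (simp_all add: mult_le_cancel_right1)
    then have "x' div B ^ m + y' div B ^ m \<noteq> 0"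
      using last m[of "x' div B ^ m"] m[of "y' div B ^ m"] *(5) Suc assms by linarith
    moreover have "settled_below B (x' div B ^ m) (y' div B ^ m)"
      by (subst last(1), subst last(2)) (rule children[OF m m])
    ultimately show ?thesis
      using settled_belowD *(1,2) by blast
  qed
qed

lemma search_sound:
  assumes "search k B i j x y u d" "B \<ge> 2" "i < B" "j < B"
    and "x = B * x'" "y = B * y'" "0 \<le> x'" "0 \<le> y'" "hsum B x' y' = (u, d)"
    and "0 \<le> i'" "0 \<le> j'" "j' < B" "i' < i \<or> i' = i \<and> j' \<le> j"
  shows "settled_below B (x + i') (y + j')"
  using assms
proof (induction k B i j x y u d arbitrary: x' y' i' j' rule: search.induct)
  case (1 k B i j x y u d)
  \<comment> \<open>The four induction hypotheses follow the recursive calls: next row, skipping a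
    \<open>small_norm\<close> pair, appending a digit pair, next pair in the row.\<close>
  note IH = "1.IH" and prems = "1.prems"
  have i: "0 \<le> i" using prems by linarith
  show ?case
  proof (cases "j < 0")
    case True
    then have "search k B (i - 1) (B - 1) x y u d"
      using prems(1) i by (subst (asm) search.simps) simp
    then show ?thesis
      by (intro IH(1)[of x' y']) (use prems i True in auto)
  next
    case j: False
    define p where "p = (u + (i\<^sup>2 - j\<^sup>2), d + 2 * i * j)"
    define f where "f = x + i + (y + j)"
    have p: "hsum B (x + i) (y + j) = p"
      using hsum_digit[of B x' y' i j] prems i j by (simp add: p_def)
    have nn: "0 \<le> x + i" "0 \<le> y + j" using prems i j by simp_all
    have s: "search k B i j x y u d =
      (if small_norm B f p then search k B i (j - 1) x y u d
       else if (if (y + j) mod 2 = 0 then descends 80 B f p else True) then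
         (if small_below B f p then True
          else if k \<le> 0 then False
          else search (k - 1) B (B - 1) (B - 1) (B * (x + i)) (B * (y + j))
            (u + (i\<^sup>2 - j\<^sup>2)) (d + 2 * i * j)) \<and> search k B i (j - 1) x y u d
       else False)"
      by (subst search.simps) (use i j in \<open>simp add: p_def f_def\<close>)
    have rest: "search k B i (j - 1) x y u d" using prems(1) s by (simp split: if_splits)
    have desc: "if (y + j) mod 2 = 0 then descends 80 B f p else True" if "\<not> small_norm B f p"
      using prems(1) s that by (simp split: if_splits)
    show ?thesis
    proof (cases "i' = i \<and> j' = j")
      case False
      show ?thesis
      proof (cases "small_norm B f p")
        case True
        then show ?thesis
          by (intro IH(2)[of x' y']) (use rest prems i j False in \<open>auto simp: p_def f_def\<close>)
      next
        case ns: False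
        then show ?thesis
          by (intro IH(4)[of x' y'])
            (use ns rest desc prems i j False in \<open>auto simp: p_def f_def\<close>)
      qed
    next
      case ij: True
      show ?thesis
      proof (cases "small_norm B f p")
        case True
        show ?thesis
          unfolding settled_below_def
        proof (intro allI impI)
          fix n x'' y''
          assume *: "0 \<le> x''" "0 \<le> y''" "x'' div B ^ n = x + i'" "y'' div B ^ n = y + j'"
          then have "small_norm B (x'' + y'') (hsum B x'' y'')"
            using small_norm_extend[OF prems(2) *(1,2), of n] True p ij by (simp add: f_def)
          then show "settles B (set (cycle_reps B)) (x'', y'')"
            using settlesI_small * by (auto simp: small_norm_def)
        qed
      next
        case ns: False
        \<comment> \<open>For odd \<open>y + j\<close> this is vacuous by the parity premise in
          \<open>settles\<close>; extensions may have even imaginary part and are still treated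
          below.\<close>
        have settles: "settles B (set (cycle_reps B)) (x + i, y + j)"
          using settlesI_descends[OF nn] desc[OF ns] p
          by (cases "even (y + j)") (simp_all add: f_def settles_def even_iff_mod_2_eq_zero)
        show ?thesis
        proof (cases "small_below B f p")
          case True
          show ?thesis
            unfolding settled_below_def
          proof (intro allI impI)
            fix n x'' y''
            assume *: "0 \<le> x''" "0 \<le> y''" "x'' div B ^ n = x + i'" "y'' div B ^ n = y + j'"
              "n = 0 \<or> x + i' + (y + j') \<noteq> 0"
            show "settles B (set (cycle_reps B)) (x'', y'')"
            proof (cases n)
              case 0
              then show ?thesis using * settles ij by simp
            next
              case (Suc m)
              then have "norm1 p + 2 * (B - 1)\<^sup>2 < B * f"
                using True * ij by (simp add: small_below_def f_def)
              then show ?thesis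
                using small_below_extend[OF prems(2) *(1,2), of n] p ij * Suc settlesI_small
                by (simp add: f_def)
            qed
          qed
        next
          case nb: False
          then have k: "\<not> k \<le> 0" and sub: "search (k - 1) B (B - 1) (B - 1) (B * (x + i)) (B * (y + j))
            (u + (i\<^sup>2 - j\<^sup>2)) (d + 2 * i * j)"
            using prems(1) s ns by (simp_all split: if_splits)
          have "settled_below B (B * (x + i) + i'') (B * (y + j) + j'')"
            if "0 \<le> i''" "i'' < B" "0 \<le> j''" "j'' < B" for i'' j''
            by (intro IH(3)[of "x + i" "y + j"])
              (use sub desc[OF ns] ns nb k that prems i j nn p in \<open>auto simp: p_def f_def\<close>)
          then show ?thesis
            using settled_below_children[OF prems(2) settles nn] ij by simp
        qed
      qed
    qed
  qed
qed

lemma settles_from_search: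
  assumes s: "search k B (B - 1) (B - 1) 0 0 0 0" and B: "B \<ge> 2" and "0 \<le> x" "0 \<le> y"
  shows "settles B (set (cycle_reps B)) (x, y)"
proof -
  have below: "settled_below B i j" if "0 \<le> i" "i < B" "0 \<le> j" "j < B" for i j
    using search_sound[OF s B _ _ _ _ _ _ hsum_zero, of i j] that B by (cases "i = B - 1") simp_all
  \<comment> \<open>One digit less than this removes everything but the leading digit pair, which is
    nonzero and below \<open>B\<close>, so the root of the search covers it.\<close>
  define n where "n = (LEAST n. x div B ^ n = 0 \<and> y div B ^ n = 0)"
  have "z div B ^ nat (x + y) = 0" if "0 \<le> z" "z \<le> x + y" for z
  proof -
    have "x + y < 2 ^ nat (x + y)"
      using less_exp[of "nat (x + y)"] assms(3,4)
      by (metis add_nonneg_nonneg int_nat_eq of_nat_less_iff of_nat_numeral of_nat_power)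
    also have "(2::int) ^ nat (x + y) \<le> B ^ nat (x + y)" using B by (simp add: power_mono)
    finally show ?thesis using that by simp
  qed
  then have ex: "x div B ^ nat (x + y) = 0 \<and> y div B ^ nat (x + y) = 0" using assms by simp
  then have n: "x div B ^ n = 0" "y div B ^ n = 0"
    unfolding n_def by (rule LeastI2, blast)+
  show ?thesis
  proof (cases n)
    case 0
    then show ?thesis
      using n below[of 0 0] B settled_belowD[of B x 0 y] assms(3,4) by simp
  next
    case (Suc m)
    then have "\<not> (x div B ^ m = 0 \<and> y div B ^ m = 0)"
      using not_less_Least[of m "\<lambda>n. x div B ^ n = 0 \<and> y div B ^ n = 0"]
      by (simp add: n_def[symmetric])
    moreover have nn: "0 \<le> x div B ^ m" "0 \<le> y div B ^ m"
      using assms by (simp_all add: pos_imp_zdiv_nonneg_iff)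
    moreover have "z < B" if "z div B = 0" for z
      using mult_div_mod_eq[of B z] pos_mod_bound[of B z] that B by simp
    then have "x div B ^ m < B" "y div B ^ m < B"
      using n unfolding Suc div_power_Suc_right[OF B] by blast+
    ultimately show ?thesis
      using settled_belowD[OF below assms(3,4)] by (simp add: add_nonneg_eq_0_iff)
  qed
qed

subsection \<open>Evaluation\<close>

text \<open>Division by repeated subtraction of \<open>b = B * s\<close>, each worth
  \<open>s\<close> in the quotient, so that \<open>B * q + r\<close> is invariant.\<close>

function subtract_multiples :: "int \<Rightarrow> int \<Rightarrow> int \<times> int \<Rightarrow> int \<times> int" where
  "subtract_multiples s b (q, r) =
     (if r < b then (q, r) else if b \<le> 0 then (q, r) else subtract_multiples s b (q + s, r - b))"
  by pat_completeness auto
termination by (relation "measure (\<lambda>(s, b, q, r). nat r)") auto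

declare subtract_multiples.simps [simp del]

lemma subtract_multiples_invariant:
  assumes "0 \<le> snd p" "b = B * s" "b > 0"
  shows "B * fst (subtract_multiples s b p) + snd (subtract_multiples s b p) = B * fst p + snd p"
    and "0 \<le> snd (subtract_multiples s b p)" "snd (subtract_multiples s b p) < b"
  using assms
proof (induction s b p rule: subtract_multiples.induct)
  case (1 s b q r)
  {
    case 1
    then show ?case using "1.IH" by (subst (1 2) subtract_multiples.simps) (auto simp: algebra_simps)
  next
    case 2
    then show ?case using "1.IH" by (subst subtract_multiples.simps) auto
  next
    case 3
    then show ?case using "1.IH" by (subst subtract_multiples.simps) auto
  }
qed

text \<open>For the small numbers met here this is evaluated several times faster than \<open>div\<close> and \<open>mod\<close>.\<close>

definition split_digit :: "int \<Rightarrow> int \<Rightarrow> int \<times> int" where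
  "split_digit B x = subtract_multiples 1 B (subtract_multiples B (B * B) (0, x))"

lemma split_digit_eq: "split_digit B x = (x div B, x mod B)" if "B > 0" "0 \<le> x"
proof -
  define p where "p = subtract_multiples B (B * B) (0, x)"
  have p: "B * fst p + snd p = x" "0 \<le> snd p"
    using subtract_multiples_invariant[of "(0, x)" "B * B" B B] that by (simp_all add: p_def)
  define q where "q = subtract_multiples 1 B p"
  have "B * fst q + snd q = x" "0 \<le> snd q" "snd q < B"
    using subtract_multiples_invariant[of p B B 1] p that by (simp_all add: q_def)
  then have "x div B = fst q" "x mod B = snd q"
    by (auto simp flip: \<open>B * fst q + snd q = x\<close>)
  then show ?thesis by (simp add: split_digit_def p_def q_def)
qed

text \<open>Taking quotient and remainder as an already evaluated pair avoids recomputing them at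
  each occurrence.\<close>

fun prepend_digits :: "int \<Rightarrow> int \<times> int \<Rightarrow> int \<times> int \<Rightarrow> int \<times> int" where
  "prepend_digits B (q, i) (r, j) = (case hsum B q r of (u, d) \<Rightarrow> (u + (i * i - j * j), d + 2 * i * j))"

lemma hsum_code [code]:
  "hsum B x y =
     (if B < 2 then (0, 0) else if x < 0 then (0, 0) else if y < 0 then (0, 0)
      else if (if x = 0 then y = 0 else False) then (0, 0)
      else prepend_digits B (split_digit B x) (split_digit B y))"
  by (subst hsum.simps) (simp add: split_digit_eq power2_eq_square)

text \<open>Passing the new prefix and its image as arguments lets them be evaluated once instead of
  at every occurrence in \<open>search\<close>.\<close>

definition search_child where
  "search_child k B i j x y u d x' y' u' d' =
     (if small_norm B (x' + y') (u', d') then search k B i (j - 1) x y u d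
      else if (if y' mod 2 = 0 then descends 80 B (x' + y') (u', d') else True)
      then if (if small_below B (x' + y') (u', d') then True
          else if k \<le> 0 then False
          else search (k - 1) B (B - 1) (B - 1) (B * x') (B * y') u' d')
        then search k B i (j - 1) x y u d else False
      else False)"

lemma search_code [code]:
  "search k B i j x y u d =
     (if i < 0 then True
      else if j < 0 then search k B (i - 1) (B - 1) x y u d
      else search_child k B i j x y u d (x + i) (y + j) (u + (i * i - j * j)) (d + 2 * i * j))"
  by (subst search.simps) (simp add: search_child_def power2_eq_square)

lemma small_below_code [code]:
  "small_below B f p = (if f = 0 then True else norm1 p + 2 * ((B - 1) * (B - 1)) < B * f)"
  by (simp add: small_below_def power2_eq_square)

lemma small_norm_code [code]:
  "small_norm B f p = (if norm1 p < f then 2 * (B - 1) \<le> f else False)"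
  by (simp add: small_norm_def)

section \<open>Numerals and cycles as integer pairs\<close>

function digit_value :: "int \<Rightarrow> int \<Rightarrow> int" where
  "digit_value B n = (if n \<le> 0 then 0 else digit_value B (n div 10) * B + n mod 10)"
  by pat_completeness auto
termination by (relation "measure (\<lambda>(B, n). nat n)") auto

declare digit_value.simps [simp del]

lemma digit_value_digit_string: "int (digit_string B n) = digit_value (int B) (int n)"
proof (induction B n rule: digit_string.induct)
  case (1 B n)
  then show ?case
    by (subst digit_string.simps, subst digit_value.simps) (auto simp: zdiv_int zmod_int)
qed

definition numeral_pair :: "nat \<Rightarrow> int \<times> int \<Rightarrow> int \<times> int" where
  "numeral_pair B p =
     (sgn (fst p) * digit_value (int B) \<bar>fst p\<bar>, sgn (snd p) * digit_value (int B) \<bar>snd p\<bar>)"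

lemma gauss_numeral_of_pair: "gauss_numeral B = of_pair \<circ> numeral_pair B"
  by (auto simp: gauss_numeral_def of_pair_def numeral_pair_def digit_value_digit_string)

definition conj_pair :: "int \<times> int \<Rightarrow> int \<times> int" where
  "conj_pair p = (fst p, - snd p)"

text \<open>Comparison with \<open>rotate1\<close> checks all steps, including the return from last
  to first, in one executable equation.\<close>

definition happy_cycle :: "nat \<Rightarrow> (int \<times> int) list \<Rightarrow> bool" where
  "happy_cycle B ps \<longleftrightarrow> ps \<noteq> [] \<and> distinct ps \<and> map (happy_pair B) ps = rotate1 ps"

lemma happy_pair_conj_pair: "happy_pair B (conj_pair p) = conj_pair (happy_pair B p)"
  by (simp add: happy_pair_def conj_pair_def split_beta sgn_minus)

text \<open>The happy function commutes with conjugation, so only one of two conjugate cycles needs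
  evaluation.\<close>

lemma happy_cycle_conj_pair:
  assumes "happy_cycle B ps"
  shows "happy_cycle B (map conj_pair ps)"
proof -
  have "map (happy_pair B) (map conj_pair ps) = map conj_pair (map (happy_pair B) ps)"
    by (simp add: happy_pair_conj_pair comp_def)
  moreover have "inj_on conj_pair (set ps)"
    by (auto simp: inj_on_def conj_pair_def prod_eq_iff)
  ultimately show ?thesis
    using assms by (simp add: happy_cycle_def distinct_map rotate1_map del: map_map)
qed

lemma cycle_listing_of_pair:
  assumes "B \<ge> 2" "happy_cycle B ps"
  shows "cycle_listing B (map of_pair ps)"
proof -
  have ne: "ps \<noteq> []" using assms(2) by (simp add: happy_cycle_def)
  have step: "gauss_happy B (of_pair (ps ! j)) = of_pair (ps ! (Suc j mod length ps))"
    if "j < length ps" for j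
    using assms that nth_rotate1[OF that] by (metis gauss_happy_of_pair happy_cycle_def nth_map)
  have "last ps = ps ! (length ps - 1)" "hd ps = ps ! 0"
    using ne by (simp_all add: last_conv_nth hd_conv_nth)
  then have "gauss_happy B (of_pair (last ps)) = of_pair (hd ps)"
    using step[of "length ps - 1"] ne by simp
  moreover have "distinct (map of_pair ps)"
    using assms(2) by (simp add: happy_cycle_def distinct_map inj_on_def)
  ultimately show ?thesis
    using ne step by (auto simp: cycle_listing_def last_map hd_map)
qed

text \<open>Depth 3 means at most four digits. A point with exactly four has norm at least
  \<open>B^3\<close> and image norm at most \<open>8 * (B - 1)^2\<close>; since
  \<open>10 * (B - 1)^2 < B^4\<close> for \<open>B >= 2\<close>, \<open>small_below\<close> then
  holds.\<close>

definition exhaustive :: "int \<Rightarrow> bool" where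
  "exhaustive B \<longleftrightarrow> search 3 B (B - 1) (B - 1) 0 0 0 0"

text \<open>\<open>L\<close> collects the cycles listed alone, \<open>M\<close> those to be
  completed by conjugates. The inclusion matches the decimal representatives, with both signs of the
  imaginary part, against the base \<open>B\<close> numerals.\<close>

definition verified :: "nat \<Rightarrow> (int \<times> int) set \<Rightarrow> (int \<times> int) list set \<Rightarrow> (int \<times> int) list set \<Rightarrow> bool" where
  "verified B F L M \<longleftrightarrow> 2 \<le> B \<and>
     (\<forall>p\<in>F. happy_pair B (numeral_pair B p) = numeral_pair B p) \<and>
     (\<forall>l\<in>L \<union> M. 2 \<le> length l \<and> happy_cycle B (map (numeral_pair B) l)) \<and>
     set (cycle_reps (int B)) \<union> conj_pair ` set (cycle_reps (int B)) \<subseteq>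
       numeral_pair B ` (F \<union> \<Union> (set ` L) \<union> \<Union> (set ` M)) \<union>
       conj_pair ` numeral_pair B ` \<Union> (set ` M)"

lemma classification:
  assumes "exhaustive (int B)" and v: "verified B F L M"
  shows "fixed_points B = gauss_numeral B ` F \<and>
    cycles_are B (map (gauss_numeral B) ` L \<union> with_conjugates (map (gauss_numeral B) ` M))"
proof (rule classification_from_representatives)
  show B: "B \<ge> 2" using v by (simp add: verified_def)
  show "settles (int B) (set (cycle_reps (int B))) (x, y)" if "0 \<le> x" "0 \<le> y" for x y
    using settles_from_search assms(1) B that by (simp add: exhaustive_def)
  have cnj: "cnj (of_pair p) = of_pair (conj_pair p)" for p
    by (simp add: cnj_of_pair conj_pair_def)
  define P where "P = numeral_pair B ` (F \<union> \<Union> (set ` L) \<union> \<Union> (set ` M)) \<union>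
    conj_pair ` numeral_pair B ` \<Union> (set ` M)"
  have P: "of_pair ` P \<subseteq> gauss_numeral B ` F \<union>
    \<Union> (set ` (map (gauss_numeral B) ` L \<union> with_conjugates (map (gauss_numeral B) ` M)))"
    unfolding P_def with_conjugates_def gauss_numeral_of_pair
    by (force simp: image_iff cnj)
  show "of_pair (u, d) \<in> gauss_numeral B ` F \<union>
      \<Union> (set ` (map (gauss_numeral B) ` L \<union> with_conjugates (map (gauss_numeral B) ` M))) \<and>
    of_pair (u, - d) \<in> gauss_numeral B ` F \<union>
      \<Union> (set ` (map (gauss_numeral B) ` L \<union> with_conjugates (map (gauss_numeral B) ` M)))"
    if "(u, d) \<in> set (cycle_reps (int B))" for u d
  proof -
    have "(u, d) \<in> P" "(u, - d) \<in> P"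
      using v that unfolding verified_def P_def[symmetric] by (force simp: conj_pair_def)+
    then show ?thesis using P by blast
  qed
  show "z \<in> gauss_ints \<and> gauss_happy B z = z" if "z \<in> gauss_numeral B ` F" for z
    using v that by (auto simp: verified_def gauss_numeral_of_pair gauss_happy_of_pair)
  show "cycle_listing B gs \<and> length gs \<ge> 2"
    if gs: "gs \<in> map (gauss_numeral B) ` L \<union> with_conjugates (map (gauss_numeral B) ` M)" for gs
  proof -
    have "map (gauss_numeral B) l = map of_pair (map (numeral_pair B) l)"
      "map cnj (map (gauss_numeral B) l) = map of_pair (map conj_pair (map (numeral_pair B) l))" for l
      by (simp_all add: gauss_numeral_of_pair cnj)
    moreover have "\<exists>l\<in>L \<union> M. gs = map (gauss_numeral B) l \<or> gs = map cnj (map (gauss_numeral B) l)"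
      using gs by (auto simp: with_conjugates_def simp del: map_map)
    ultimately obtain l where l: "l \<in> L \<union> M" "gs = map of_pair (map (numeral_pair B) l) \<or>
        gs = map of_pair (map conj_pair (map (numeral_pair B) l))"
      by metis
    moreover have "happy_cycle B (map (numeral_pair B) l)" "2 \<le> length l"
      using v l(1) by (auto simp: verified_def)
    ultimately show ?thesis
      using cycle_listing_of_pair[OF B] happy_cycle_conj_pair by (metis length_map)
  qed
qed

lemma classification_real:
  assumes "exhaustive (int B)" "verified B F L {}"
  shows "fixed_points B = gauss_numeral B ` F \<and> cycles_are B (map (gauss_numeral B) ` L)"
  using classification[OF assms] by (simp add: with_conjugates_def)

lemma classification_no_cycles:
  assumes "exhaustive (int B)" "verified B F {} {}"
  shows "fixed_points B = gauss_numeral B ` F \<and> cycles_are B {}"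
  using classification[OF assms] by (simp add: with_conjugates_def)

lemma exhaustive_2: "exhaustive (int 2)"
  by code_simp

lemma exhaustive_3: "exhaustive (int 3)"
  by code_simp

lemma exhaustive_4: "exhaustive (int 4)"
  by code_simp

lemma exhaustive_5: "exhaustive (int 5)"
  by code_simp

lemma exhaustive_6: "exhaustive (int 6)"
  by code_simp

lemma exhaustive_7: "exhaustive (int 7)"
  by code_simp

lemma exhaustive_8: "exhaustive (int 8)"
  by code_simp

lemma exhaustive_9: "exhaustive (int 9)"
  by code_simp

lemma exhaustive_10: "exhaustive (int 10)"
  by code_simp

theorem theorem6:
  shows "(fixed_points 2 = gauss_numeral 2 `
       {(0, 0), (1, 0)} \<and>
     cycles_are 2 {}) \<and>
    (fixed_points 3 = gauss_numeral 3 `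
       {(0, 0), (1, 0), (12, 0), (22, 0), (2, 11), (2, -11)} \<and>
     cycles_are 3
       (map (gauss_numeral 3) `
         {[(2, 0), (11, 0)]} \<union>
        with_conjugates (map (gauss_numeral 3) `
         {[(-1, 2), (-10, -11)],
          [(-11, 22), (-20, -22)]}))) \<and>
    (fixed_points 4 = gauss_numeral 4 `
       {(0, 0), (1, 0)} \<and>
     cycles_are 4 {}) \<and>
    (fixed_points 5 = gauss_numeral 5 `
       {(0, 0), (1, 0), (23, 0), (33, 0)} \<and>
     cycles_are 5
       (map (gauss_numeral 5) `
         {[(4, 0), (31, 0), (20, 0)]} \<union>
        with_conjugates (map (gauss_numeral 5) `
         {[(3, 11), (12, 11)]}))) \<and>
    (fixed_points 6 = gauss_numeral 6 `
       {(0, 0), (1, 0)} \<and>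
     cycles_are 6
       (map (gauss_numeral 6) `
         {[(5, 0), (41, 0), (25, 0), (45, 0), (105, 0), (42, 0), (32, 0), (21, 0)]})) \<and>
    (fixed_points 7 = gauss_numeral 7 `
       {(0, 0), (1, 0), (13, 0), (34, 0), (44, 0), (63, 0), (25, 31), (25, -31)} \<and>
     cycles_are 7
       (map (gauss_numeral 7) `
         {[(2, 0), (4, 0), (22, 0), (11, 0)],
          [(16, 0), (52, 0), (41, 0), (23, 0)],
          [(-15, 116), (-15, -116)],
          [(-31, 44), (-31, -44)],
          [(14, 35), (-23, 64), (-54, -66), (-43, 213), (14, -35), (-23, -64), (-54, 66),
           (-43, -213)],
          [(-13, 15), (-22, -44), (-33, 44), (-20, -66), (-125, 33), (15, -60), (-13, -15),
           (-22, 44), (-33, -44), (-20, 66), (-125, -33), (15, 60)]} \<union>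
        with_conjugates (map (gauss_numeral 7) `
         {[(-11, 51), (-33, -15)],
          [(-21, 26), (-50, -26)],
          [(-1, 13), (-12, -6), (-43, 33), (10, -60), (-50, -15)],
          [(4, 22), (11, 22), (-6, 11), (46, -15), (35, -125), (4, -116), (-31, -66), (-116, 66),
           (-46, -150), (35, 55), (-22, 143), (-24, -40)]}))) \<and>
    (fixed_points 8 = gauss_numeral 8 `
       {(0, 0), (1, 0), (24, 0), (64, 0), (15, 32), (15, -32), (45, 20), (45, -20)} \<and>
     cycles_are 8
       (map (gauss_numeral 8) `
         {[(4, 0), (20, 0)],
          [(15, 0), (32, 0)],
          [(5, 0), (31, 0), (12, 0)],
          [(-34, 72), (-34, -72)]} \<union>
        with_conjugates (map (gauss_numeral 8) `
         {[(-11, 24), (-22, -14)],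
          [(-40, 70), (-41, -70)],
          [(4, 6), (-24, 60), (-20, -30), (-5, 14), (10, -50), (-30, -12)]}))) \<and>
    (fixed_points 9 = gauss_numeral 9 `
       {(0, 0), (1, 0), (45, 0), (55, 0)} \<and>
     cycles_are 9
       (map (gauss_numeral 9) `
         {[(75, 0), (82, 0)],
          [(58, 0), (108, 0), (72, 0)],
          [(10, 26), (-43, 4), (10, -26), (-43, -4)]} \<union>
        with_conjugates (map (gauss_numeral 9) `
         {[(-4, 26), (-26, -53), (6, 62)]}))) \<and>
    (fixed_points 10 = gauss_numeral 10 `
       {(0, 0), (1, 0)} \<and>
     cycles_are 10
       (map (gauss_numeral 10) `
         {[(4, 0), (16, 0), (37, 0), (58, 0), (89, 0), (145, 0), (42, 0), (20, 0)],
          [(-52, 90), (-52, -90)],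
          [(35, 48), (-46, 104), (35, -48), (-46, -104)]} \<union>
        with_conjugates (map (gauss_numeral 10) `
         {[(-15, 90), (-55, -18)]})))"
proof -
  note no_cycles = classification_no_cycles and real = classification_real
    and general = classification
  show ?thesis
    \<comment> \<open>The goals left by the rule are the nine \<open>verified\<close> conditions,
      decided by evaluation.\<close>
    by (rule
        conjI[OF no_cycles[OF exhaustive_2]
        conjI[OF general[OF exhaustive_3]
        conjI[OF no_cycles[OF exhaustive_4]
        conjI[OF general[OF exhaustive_5]
        conjI[OF real[OF exhaustive_6]
        conjI[OF general[OF exhaustive_7]
        conjI[OF general[OF exhaustive_8]
        conjI[OF general[OF exhaustive_9] general[OF exhaustive_10]]]]]]]]]; code_simp)
qed

end
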